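(* Let $p\geq 0$ and $m\ge 1$ be integers. For all integers $n\geq m$, $$\sum_{k=0}^{p-1} \sum_{j=0}^{n-m-k} F_j^{(m)} F_{n-m-k-j}^{(m+p)} = F_n^{(m+p)} - F_n^{(m)}.$$
   Context: For each integer $m\ge 1$ the Fibonacci $m$-step numbers $F_n^{(m)}$ are defined by $F_n^{(m)}=0$ for $n=-(m-2),\ldots,0$ (with $F_0^{(1)}=0$ when $m=1$), $F_1^{(m)}=1$, and $F_n^{(m)}=\sum_{j=1}^m F_{n-j}^{(m)}$ for all $n\ge 2$. Sums whose upper limit is smaller than the lower limit are empty and equal $0$ (in particular the inner sum is $0$ when $n-m-k<0$, and the outer sum is $0$ when $p=0$). *)

theory Defs
  imports Main
begin

text \<open>
  The Fibonacci \<open>m\<close>-step numbers. They are indexed by integers, since the recurrence reaches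
  back to the initial zeros at the indices \<open>-(m - 2), \<dots>, 0\<close>. The indices below that range,
  where the sequence is not specified, also receive the value \<open>0\<close>; for \<open>m \<ge> 1\<close> the
  recurrence never consults them.
\<close>

function fib_step :: "nat \<Rightarrow> int \<Rightarrow> int" where
  "fib_step m n =
     (if n \<le> 0 then 0
      else if n = 1 then 1
      else (\<Sum>j = 1..m. fib_step m (n - int j)))"
  by auto
termination
  by (relation "measure (\<lambda>(m, n). nat n)") auto

text \<open>As a rewrite rule the unconditional equation would loop.\<close>

declare fib_step.simps [simp del]

lemma fib_step_nonpos: "n \<le> 0 \<Longrightarrow> fib_step m n = 0"
  by (simp add: fib_step.simps)

lemma fib_step_1: "fib_step m 1 = 1"
  by (simp add: fib_step.simps)

lemma fib_step_rec: "n \<ge> 2 \<Longrightarrow> fib_step m n = (\<Sum>j = 1..m. fib_step m (n - int j))"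
  by (subst fib_step.simps) simp

end

theory Submission imports Defs begin

text \<open>
  Write \<open>F\<close> and \<open>G\<close> for the \<open>m\<close>-step and the \<open>(m + p)\<close>-step numbers, extended by \<open>0\<close> to the
  negative indices. Both sides of the identity, as functions of \<open>n\<close>, solve the same inhomogeneous
  \<open>m\<close>-step recurrence
  \[ X(n) = \sum_{i=1}^{m} X(n-i) + \sum_{i=m+1}^{m+p} G(n-i), \]
  and both vanish for \<open>n \<le> 0\<close>, so they agree. For the difference \<open>G - F\<close> the inhomogeneous term
  consists of the \<open>p\<close> summands by which the recurrence of \<open>G\<close> exceeds that of \<open>F\<close>
  (\<open>fib_step_diff_rec\<close>). For the left-hand side it comes from the convolution: \<open>F\<close> is the response
  of the \<open>m\<close>-step recurrence to a unit impulse at \<open>1\<close> (\<open>fib_step_impulse\<close>), so convolving \<open>F\<close> with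
  \<open>G\<close> gives the response to \<open>G\<close> delayed by one step (\<open>fib_conv_rec\<close>), and the \<open>p\<close> shifts by
  \<open>m + k\<close> with \<open>k < p\<close> turn this into the summands \<open>G(n - i)\<close> with \<open>m < i \<le> m + p\<close>. Because the
  recurrences hold at every integer \<open>n\<close>, no initial segment has to be checked separately.
\<close>

text \<open>The impulse at \<open>1\<close> absorbs the initial conditions, so that this form of the recurrence can be
  summed over all indices without boundary terms.\<close>

lemma fib_step_impulse:
  "fib_step m n = (if n = 1 then 1 else 0) + (\<Sum>i = 1..m. fib_step m (n - int i))"
proof (cases "n \<ge> 2")
  case True
  then show ?thesis by (simp add: fib_step_rec)
next
  case False
  then have "(\<Sum>i = 1..m. fib_step m (n - int i)) = 0"
    by (intro sum.neutral) (auto intro: fib_step_nonpos)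
  with False show ?thesis
    by (auto simp: fib_step_1 fib_step_nonpos)
qed

definition fib_conv :: "nat \<Rightarrow> (int \<Rightarrow> int) \<Rightarrow> int \<Rightarrow> int" where
  "fib_conv m g N = (\<Sum>j = 0..N. fib_step m j * g (N - j))"

lemma fib_conv_nonpos: "N \<le> 0 \<Longrightarrow> fib_conv m g N = 0"
  unfolding fib_conv_def by (rule sum.neutral) (auto simp: fib_step_nonpos)

text \<open>Delaying \<open>F\<close> by \<open>i\<close> steps delays the convolution by \<open>i\<close> steps: the terms that the shift of the
  summation range brings in have negative indices in \<open>F\<close>.\<close>

lemma fib_conv_shift:
  "(\<Sum>j = 0..N. fib_step m (j - int i) * g (N - j)) = fib_conv m g (N - int i)"
proof -
  have "(\<Sum>j = 0..N. fib_step m (j - int i) * g (N - j))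
      = (\<Sum>j = - int i..N - int i. fib_step m j * g (N - int i - j))"
    by (rule sum.reindex_bij_witness[of _ "\<lambda>j. j + int i" "\<lambda>j. j - int i"]) auto
  also have "\<dots> = (\<Sum>j = 0..N - int i. fib_step m j * g (N - int i - j))"
    by (rule sum.mono_neutral_right) (auto simp: fib_step_nonpos)
  finally show ?thesis
    by (simp add: fib_conv_def)
qed

lemma fib_conv_rec:
  assumes g: "\<And>x. x < 0 \<Longrightarrow> g x = 0"
  shows "fib_conv m g N = g (N - 1) + (\<Sum>i = 1..m. fib_conv m g (N - int i))"
proof -
  have "fib_conv m g N = (\<Sum>j = 0..N. (if j = 1 then g (N - j) else 0)
          + (\<Sum>i = 1..m. fib_step m (j - int i) * g (N - j)))"
    unfolding fib_conv_def
    by (rule sum.cong[OF refl], subst fib_step_impulse) (simp add: distrib_right sum_distrib_right)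
  also have "\<dots> = (\<Sum>j = 0..N. if j = 1 then g (N - j) else 0)
          + (\<Sum>i = 1..m. \<Sum>j = 0..N. fib_step m (j - int i) * g (N - j))"
    by (simp only: sum.distrib sum.swap[of _ "{1..m}"])
  also have "(\<Sum>j = 0..N. if j = 1 then g (N - j) else 0) = g (N - 1)"
    using g by simp
  finally show ?thesis
    by (simp only: fib_conv_shift)
qed

lemma fib_step_diff_rec:
  "fib_step (m + p) n - fib_step m n
     = (\<Sum>i = 1..m. fib_step (m + p) (n - int i) - fib_step m (n - int i))
       + (\<Sum>k = 0..<p. fib_step (m + p) (n - int m - int k - 1))"
proof -
  let ?G = "fib_step (m + p)"
  have "(\<Sum>i = 1..m + p. ?G (n - int i))
      = (\<Sum>i = 1..m. ?G (n - int i)) + (\<Sum>i = m + 1..m + p. ?G (n - int i))"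
    by (rule sum.ub_add_nat) simp
  also have "(\<Sum>i = m + 1..m + p. ?G (n - int i)) = (\<Sum>k = 0..<p. ?G (n - int m - int k - 1))"
    by (rule sum.reindex_bij_witness[of _ "\<lambda>k. m + 1 + k" "\<lambda>i. i - (m + 1)"])
       (auto simp: of_nat_diff algebra_simps)
  finally show ?thesis
    by (subst (1 2) fib_step_impulse) (simp add: sum_subtractf)
qed

text \<open>The identity at every integer \<open>n\<close>. The range \<open>n \<ge> m\<close> would be too narrow for the induction,
  since the recurrence leads out of it.\<close>

lemma sum_fib_conv_eq_fib_step_diff:
  "(\<Sum>k = 0..<p. fib_conv m (fib_step (m + p)) (n - int m - int k))
     = fib_step (m + p) n - fib_step m n"
proof (induction "nat n" arbitrary: n rule: less_induct)
  case less
  let ?G = "fib_step (m + p)"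
  let ?C = "fib_conv m ?G"
  show ?case
  proof (cases "n \<le> 0")
    case True
    then show ?thesis by (simp add: fib_conv_nonpos fib_step_nonpos)
  next
    case False
    have "?C (n - int m - int k) = ?G (n - int m - int k - 1)
            + (\<Sum>i = 1..m. ?C (n - int i - int m - int k))" for k
      using fib_conv_rec[of ?G m "n - int m - int k"]
      by (simp add: fib_step_nonpos algebra_simps)
    then have "(\<Sum>k = 0..<p. ?C (n - int m - int k))
        = (\<Sum>k = 0..<p. ?G (n - int m - int k - 1))
          + (\<Sum>i = 1..m. \<Sum>k = 0..<p. ?C (n - int i - int m - int k))"
      by (simp only: sum.distrib sum.swap[of _ "{1..m}"])
    also have "(\<Sum>i = 1..m. \<Sum>k = 0..<p. ?C (n - int i - int m - int k))
        = (\<Sum>i = 1..m. ?G (n - int i) - fib_step m (n - int i))"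
      using False by (intro sum.cong refl less.hyps) auto
    finally show ?thesis
      by (simp only: fib_step_diff_rec[of m p n] add.commute)
  qed
qed

theorem theorem2p3:
  fixes p m :: nat and n :: int
  assumes "m \<ge> 1" and "n \<ge> int m"
  shows "(\<Sum>k = 0..<p. \<Sum>j = 0..n - int m - int k.
            fib_step m j * fib_step (m + p) (n - int m - int k - j))
         = fib_step (m + p) n - fib_step m n"
  using sum_fib_conv_eq_fib_step_diff[of m p n] by (simp only: fib_conv_def)

end
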